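(* Assume the standing setup below with $m\ge 3$. Then every downset $S$ of $Q$ with $|S|=n$ such that $S\not\supseteq A\setminus X$ and $S\not\supseteq C\setminus X$ is isomorphic to $B$.
   Context: Standing setup: $\Gamma_n=\{A,B,C\}$ is a set of three pairwise non-isomorphic posets of size $n$, and $Q$ is a witness of $\Gamma_n$ (every downset of $Q$ of size $n$ is isomorphic to one of $A,B,C$, and each occurs). $G_n(Q)$ is the exchange graph: vertices are all downsets of $Q$ of size $n$ (as subsets), adjacent when they differ by exactly one element. A special path is a path $v_0,\ldots,v_r$ ($r\ge2$) in $G_n(Q)$ whose first vertex, internal vertices, and last vertex are isomorphic to three distinct members of $\Gamma_n$ respectively (all internal vertices isomorphic to the same member). Fix a special path of minimal length among all special paths in $G_n(Q)$, labelled so that $v_0\cong A$, $v_1,\ldots,v_{r-1}\cong B$, $v_r\cong C$; by abuse of notation $A:=v_0$ and $C:=v_r$ denote these specific downsets (anchor copies). Assume $Q$ equals the union of the vertices of this path (when $r\ge 3$ this union is $A\cup C$). Let $X=A\cap C$ and $m=|A\setminus X|=|C\setminus X|$. *)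

theory Defs
  imports Main
begin

type_synonym 'a pos = "'a set \<times> ('a \<Rightarrow> 'a \<Rightarrow> bool)"

definition is_poset :: "'a pos \<Rightarrow> bool" where
  "is_poset P \<longleftrightarrow>
     (\<forall>x\<in>fst P. snd P x x) \<and>
     (\<forall>x\<in>fst P. \<forall>y\<in>fst P. snd P x y \<and> snd P y x \<longrightarrow> x = y) \<and>
     (\<forall>x\<in>fst P. \<forall>y\<in>fst P. \<forall>z\<in>fst P. snd P x y \<and> snd P y z \<longrightarrow> snd P x z)"

definition pos_iso :: "'a pos \<Rightarrow> 'b pos \<Rightarrow> bool" where
  "pos_iso P P' \<longleftrightarrow>
     (\<exists>f. bij_betw f (fst P) (fst P') \<and>
          (\<forall>x\<in>fst P. \<forall>y\<in>fst P. snd P x y \<longleftrightarrow> snd P' (f x) (f y)))"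

definition subpos :: "'a pos \<Rightarrow> 'a set \<Rightarrow> 'a pos" where
  "subpos Q S = (S, snd Q)"

definition downset :: "'a pos \<Rightarrow> 'a set \<Rightarrow> bool" where
  "downset Q S \<longleftrightarrow> S \<subseteq> fst Q \<and> (\<forall>x\<in>S. \<forall>y\<in>fst Q. snd Q y x \<longrightarrow> y \<in> S)"

definition exch_vertices :: "'a pos \<Rightarrow> nat \<Rightarrow> 'a set set" where
  "exch_vertices Q n = {S. downset Q S \<and> card S = n}"

definition exch_adj :: "'a set \<Rightarrow> 'a set \<Rightarrow> bool" where
  "exch_adj S T \<longleftrightarrow> card (S - T) = 1 \<and> card (T - S) = 1"

definition exch_path :: "'a pos \<Rightarrow> nat \<Rightarrow> 'a set list \<Rightarrow> bool" where
  "exch_path Q n vs \<longleftrightarrow> vs \<noteq> [] \<and> set vs \<subseteq> exch_vertices Q n \<and> distinct vs \<and>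
     (\<forall>i. Suc i < length vs \<longrightarrow> exch_adj (vs ! i) (vs ! Suc i))"

definition witness :: "'a pos \<Rightarrow> nat \<Rightarrow> 'b pos set \<Rightarrow> bool" where
  "witness Q n Gam \<longleftrightarrow>
     (\<forall>S\<in>exch_vertices Q n. \<exists>P\<in>Gam. pos_iso (subpos Q S) P) \<and>
     (\<forall>P\<in>Gam. \<exists>S\<in>exch_vertices Q n. pos_iso (subpos Q S) P)"

text \<open>Special path (r >= 2, i.e. at least 3 vertices): first, internal, last vertices isomorphic
  to three distinct members of Gamma, all internal vertices to the same member.\<close>
definition special_path :: "'a pos \<Rightarrow> nat \<Rightarrow> 'b pos set \<Rightarrow> 'a set list \<Rightarrow> bool" where
  "special_path Q n Gam vs \<longleftrightarrow> exch_path Q n vs \<and> length vs \<ge> 3 \<and>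
     (\<exists>P1\<in>Gam. \<exists>P2\<in>Gam. \<exists>P3\<in>Gam. P1 \<noteq> P2 \<and> P2 \<noteq> P3 \<and> P1 \<noteq> P3 \<and>
        pos_iso (subpos Q (hd vs)) P1 \<and>
        (\<forall>i. 0 < i \<and> i < length vs - 1 \<longrightarrow> pos_iso (subpos Q (vs ! i)) P2) \<and>
        pos_iso (subpos Q (last vs)) P3)"

end

theory Submission
  imports Defs
begin

(* The distance between two vertices S, T of the exchange graph is card (S - T): exchanging a
   maximal element of S - T for a minimal element of T - S keeps a downset. Concatenating two
   shortest walks and extracting a shortest subwalk that still meets three types shows that
   r <= d(S1, S2) + d(S2, S3) for any three vertices of pairwise different types, r being the
   length of the minimal special path. Exchange steps towards C chosen to agree with the first
   edge of the path produce vertices that would violate this bound in each of the three possible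
   types. This forces r = m, Q = A \<union> C, and that a vertex of type A missing part of A - X cannot
   contain X; a general vertex missing parts of A - X and C - X is reduced to this case by a
   vertex between it and C that contains X. Reversing the path excludes type C as well. *)

lemma pos_iso_refl: "pos_iso P P"
  unfolding pos_iso_def by (rule exI[of _ id]) auto

lemma pos_iso_sym:
  assumes "pos_iso P P'"
  shows "pos_iso P' P"
proof -
  obtain f where f: "bij_betw f (fst P) (fst P')"
    and hom: "\<forall>x\<in>fst P. \<forall>y\<in>fst P. snd P x y \<longleftrightarrow> snd P' (f x) (f y)"
    using assms unfolding pos_iso_def by blast
  let ?g = "inv_into (fst P) f"
  have "bij_betw ?g (fst P') (fst P)"
    using f by (rule bij_betw_inv_into)
  moreover have "snd P' x y \<longleftrightarrow> snd P (?g x) (?g y)" if "x \<in> fst P'" "y \<in> fst P'" for x y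
    using hom f that bij_betw_inv_into_right[OF f] bij_betwE[OF \<open>bij_betw ?g (fst P') (fst P)\<close>]
    by metis
  ultimately show ?thesis
    unfolding pos_iso_def by blast
qed

lemma pos_iso_trans:
  assumes "pos_iso P1 P2" "pos_iso P2 P3"
  shows "pos_iso P1 P3"
proof -
  obtain f where f: "bij_betw f (fst P1) (fst P2)"
    and hf: "\<forall>x\<in>fst P1. \<forall>y\<in>fst P1. snd P1 x y \<longleftrightarrow> snd P2 (f x) (f y)"
    using assms(1) unfolding pos_iso_def by blast
  obtain g where g: "bij_betw g (fst P2) (fst P3)"
    and hg: "\<forall>x\<in>fst P2. \<forall>y\<in>fst P2. snd P2 x y \<longleftrightarrow> snd P3 (g x) (g y)"
    using assms(2) unfolding pos_iso_def by blast
  have "bij_betw (g \<circ> f) (fst P1) (fst P3)"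
    using f g by (rule bij_betw_trans)
  moreover have "snd P1 x y \<longleftrightarrow> snd P3 ((g \<circ> f) x) ((g \<circ> f) y)"
    if "x \<in> fst P1" "y \<in> fst P1" for x y
    using hf hg that bij_betwE[OF f] by simp
  ultimately show ?thesis
    unfolding pos_iso_def by blast
qed

lemma card_Diff_between:
  assumes "S \<inter> T \<subseteq> U" "U \<subseteq> S \<union> T" "finite S" "finite U"
  shows "card (S - T) = card (S - U) + card (U - T)"
proof -
  have "S - T = (S - U) \<union> (U - T)" and "(S - U) \<inter> (U - T) = {}"
    using assms(1,2) by blast+
  then show ?thesis
    using assms(3,4) by (simp add: card_Un_disjoint)
qed

lemma card_Diff_triangle:
  assumes "finite S" "finite T"
  shows "card (S - U) \<le> card (S - T) + card (T - U)"
proof -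
  have "card (S - U) \<le> card ((S - T) \<union> (T - U))"
    using assms by (intro card_mono) auto
  also have "\<dots> \<le> card (S - T) + card (T - U)"
    by (rule card_Un_le)
  finally show ?thesis .
qed

lemma card_Diff_Un_le:
  assumes "finite T" "finite A" "card T = card A"
  shows "card (A - C) + card (T - (A \<union> C)) \<le> card (T - A) + card (T - C)"
proof -
  have "card T = card (T \<inter> C) + card (T - C)"
    using assms(1) by (rule card_Int_Diff)
  moreover have "card (T \<inter> C) = card (T \<inter> C \<inter> A) + card (T \<inter> C - A)"
    using assms(1) by (intro card_Int_Diff) simp
  moreover have "card (T \<inter> C \<inter> A) \<le> card (A \<inter> C)"
    using assms(2) by (intro card_mono) auto
  moreover have "card A = card (A \<inter> C) + card (A - C)"
    using assms(2) by (rule card_Int_Diff)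
  moreover have "T - A = (T \<inter> C - A) \<union> (T - (A \<union> C))"
    by blast
  then have "card (T - A) = card (T \<inter> C - A) + card (T - (A \<union> C))"
    using assms(1) by (auto intro!: card_Un_disjoint)
  ultimately show ?thesis
    using assms(3) by linarith
qed

lemma card_Diff_le_add:
  assumes "finite A" "finite S" "card S = card A" "S \<subseteq> A \<union> C"
  shows "card (A - C) \<le> card (S - C) + card (S - A)"
proof -
  have "card (S \<inter> C) \<le> card ((A \<inter> C) \<union> (S - A))"
    using assms(1,2) by (intro card_mono) auto
  also have "\<dots> \<le> card (A \<inter> C) + card (S - A)"
    by (rule card_Un_le)
  finally have "card (S \<inter> C) \<le> card (A \<inter> C) + card (S - A)" .
  then show ?thesis
    using card_Int_Diff[OF assms(1), of C] card_Int_Diff[OF assms(2), of C] assms(3) by linarith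
qed

lemma swap_between:
  assumes "A \<inter> C \<subseteq> S" "S \<subseteq> A \<union> C" "q \<in> S - C" "j \<in> C - S"
    and "\<alpha> \<in> S - C \<Longrightarrow> q = \<alpha>" "\<beta> \<in> C - S \<Longrightarrow> j = \<beta>"
  shows "insert \<beta> (A - {\<alpha>}) \<inter> C \<subseteq> insert j (S - {q})"
    and "insert j (S - {q}) \<subseteq> insert \<beta> (A - {\<alpha>}) \<union> C"
  using assms by blast+

section \<open>Walks meeting three colours\<close>

definition special_colours :: "('v \<Rightarrow> 'c) \<Rightarrow> 'v list \<Rightarrow> bool" where
  "special_colours f ws \<longleftrightarrow> 3 \<le> length ws \<and>
     f (hd ws) \<noteq> f (ws ! 1) \<and> f (ws ! 1) \<noteq> f (last ws) \<and> f (hd ws) \<noteq> f (last ws) \<and>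
     (\<forall>i. 0 < i \<and> i < length ws - 1 \<longrightarrow> f (ws ! i) = f (ws ! 1))"

lemma special_colours_rev:
  assumes "special_colours f ws"
  shows "special_colours f (rev ws)"
proof -
  let ?L = "length ws"
  have len: "3 \<le> ?L"
    and ends: "f (hd ws) \<noteq> f (ws ! 1)" "f (ws ! 1) \<noteq> f (last ws)" "f (hd ws) \<noteq> f (last ws)"
    and mid: "\<And>i. 0 < i \<Longrightarrow> i < ?L - 1 \<Longrightarrow> f (ws ! i) = f (ws ! 1)"
    using assms unfolding special_colours_def by blast+
  have rev_mid: "f (rev ws ! i) = f (ws ! 1)" if "0 < i" "i < ?L - 1" for i
  proof -
    have "rev ws ! i = ws ! (?L - 1 - i)"
      using that by (simp add: rev_nth)
    then show ?thesis
      using mid[of "?L - 1 - i"] that by simp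
  qed
  have "f (rev ws ! 1) = f (ws ! 1)"
    using rev_mid len by simp
  then show ?thesis
    unfolding special_colours_def using len ends rev_mid
    by (simp add: hd_rev last_rev)
qed

lemma special_colours_length: "special_colours f ws \<Longrightarrow> 3 \<le> length ws"
  unfolding special_colours_def by blast

lemma special_colours_image:
  assumes special: "special_colours f ws" and k: "0 < k" "k < length ws - 1"
  shows "f ` set ws = {f (hd ws), f (ws ! k), f (last ws)}"
proof
  have len: "3 \<le> length ws" and inner: "\<And>i. 0 < i \<Longrightarrow> i < length ws - 1 \<Longrightarrow> f (ws ! i) = f (ws ! 1)"
    using special unfolding special_colours_def by blast+
  have "ws \<noteq> []"
    using len by auto
  then have ends: "ws ! 0 = hd ws" "ws ! (length ws - 1) = last ws"
    by (simp_all add: hd_conv_nth last_conv_nth)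
  show "f ` set ws \<subseteq> {f (hd ws), f (ws ! k), f (last ws)}"
  proof
    fix c assume "c \<in> f ` set ws"
    then obtain i where i: "i < length ws" "c = f (ws ! i)"
      by (metis imageE in_set_conv_nth)
    then have "i = 0 \<or> i = length ws - 1 \<or> (0 < i \<and> i < length ws - 1)"
      by linarith
    then show "c \<in> {f (hd ws), f (ws ! k), f (last ws)}"
      using i ends inner[of i] inner[OF k] by auto
  qed
  show "{f (hd ws), f (ws ! k), f (last ws)} \<subseteq> f ` set ws"
    using len k \<open>ws \<noteq> []\<close> by simp
qed

lemma successively_cut:
  assumes "successively R (xs @ [y] @ ys @ [y] @ zs)"
  shows "successively R (xs @ [y] @ zs)"
proof -
  have "successively R (xs @ [y])" "successively R (y # zs)"
    using assms successively_append_iff[of R "xs @ [y]" "ys @ [y] @ zs"]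
      successively_append_iff[of R "xs @ [y] @ ys" "y # zs"] by auto
  then show ?thesis
    by (cases zs) (auto simp: successively_append_iff successively_Cons)
qed

definition colour_minimal_walk :: "('v \<Rightarrow> 'v \<Rightarrow> bool) \<Rightarrow> ('v \<Rightarrow> 'c) \<Rightarrow> 'v list \<Rightarrow> bool" where
  "colour_minimal_walk R f ws \<longleftrightarrow> successively R ws \<and>
     (\<forall>ws'. successively R ws' \<and> set ws' \<subseteq> set ws \<and> f ` set ws \<subseteq> f ` set ws' \<longrightarrow>
        length ws \<le> length ws')"

lemma colour_minimal_walkD:
  assumes "colour_minimal_walk R f ws"
  shows "successively R ws"
    and "successively R ws' \<Longrightarrow> set ws' \<subseteq> set ws \<Longrightarrow> f ` set ws \<subseteq> f ` set ws' \<Longrightarrow>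
      length ws \<le> length ws'"
  using assms unfolding colour_minimal_walk_def by blast+

lemma colour_minimal_walk_hd:
  assumes walk: "colour_minimal_walk R f ws" and "ws \<noteq> []"
  shows "f (hd ws) \<notin> f ` set (tl ws)"
proof
  assume "f (hd ws) \<in> f ` set (tl ws)"
  moreover have "set ws = insert (hd ws) (set (tl ws))"
    using \<open>ws \<noteq> []\<close> by (cases ws) auto
  ultimately have "f ` set ws \<subseteq> f ` set (tl ws)"
    by auto
  moreover have "successively R (tl ws)"
    using colour_minimal_walkD(1)[OF walk] by (cases ws) (auto simp: successively_Cons)
  ultimately have "length ws \<le> length (tl ws)"
    using colour_minimal_walkD(2)[OF walk] \<open>set ws = _\<close> by blast
  then show False
    using \<open>ws \<noteq> []\<close> by (cases ws) auto
qed

lemma colour_minimal_walk_last: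
  assumes walk: "colour_minimal_walk R f ws" and "ws \<noteq> []"
  shows "f (last ws) \<notin> f ` set (butlast ws)"
proof
  assume "f (last ws) \<in> f ` set (butlast ws)"
  moreover have ws: "ws = butlast ws @ [last ws]"
    using \<open>ws \<noteq> []\<close> by simp
  then have "set ws = insert (last ws) (set (butlast ws))"
    using \<open>ws \<noteq> []\<close> by (cases ws rule: rev_cases) auto
  ultimately have "f ` set ws \<subseteq> f ` set (butlast ws)"
    by auto
  moreover have "successively R (butlast ws)"
    using colour_minimal_walkD(1)[OF walk] ws by (metis successively_append_iff)
  ultimately have "length ws \<le> length (butlast ws)"
    using colour_minimal_walkD(2)[OF walk] \<open>set ws = _\<close> by blast
  moreover have "length (butlast ws) < length ws"
    using \<open>ws \<noteq> []\<close> by simp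
  ultimately show False
    by linarith
qed

lemma colour_minimal_walk_special:
  assumes walk: "colour_minimal_walk R f ws" and three: "card (f ` set ws) = 3"
  shows "special_colours f ws"
proof -
  have "ws \<noteq> []"
    using three by auto
  note hd_unique = colour_minimal_walk_hd[OF walk this]
    and last_unique = colour_minimal_walk_last[OF walk this]
  have len: "3 \<le> length ws"
    using three card_image_le[of "set ws" f] card_length[of ws] by simp
  have tl_mem: "ws ! i \<in> set (tl ws)" if "0 < i" "i < length ws" for i
    using that nth_mem[of "i - 1" "tl ws"] by (simp add: nth_tl)
  have butlast_mem: "ws ! i \<in> set (butlast ws)" if "i < length ws - 1" for i
    using that nth_mem[of i "butlast ws"] by (simp add: nth_butlast)
  have hd_last: "f (hd ws) \<noteq> f (last ws)"
    using hd_unique tl_mem[of "length ws - 1"] len \<open>ws \<noteq> []\<close> by (auto simp: last_conv_nth)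
  have inner: "f (ws ! i) \<in> f ` set ws - {f (hd ws), f (last ws)}"
    if "0 < i" "i < length ws - 1" for i
  proof -
    have "ws ! i \<in> set (tl ws)" "ws ! i \<in> set (butlast ws)"
      using tl_mem butlast_mem that by auto
    then have "f (ws ! i) \<noteq> f (hd ws)" "f (ws ! i) \<noteq> f (last ws)"
      using hd_unique last_unique by (metis image_eqI)+
    moreover have "ws ! i \<in> set ws"
      using that by simp
    ultimately show ?thesis
      by simp
  qed
  have "card (f ` set ws - {f (hd ws), f (last ws)}) = 1"
    using three hd_last \<open>ws \<noteq> []\<close> by (simp add: card_Diff_subset)
  then obtain c where c: "f ` set ws - {f (hd ws), f (last ws)} = {c}"
    using card_1_singletonE by blast
  have inner_c: "f (ws ! i) = c" if "0 < i" "i < length ws - 1" for i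
    using inner[OF that] c by blast
  have "1 < length ws - 1"
    using len by simp
  then show ?thesis
    unfolding special_colours_def using len hd_last inner[of 1] inner_c by auto
qed

lemma colour_minimal_walk_distinct:
  assumes walk: "colour_minimal_walk R f ws" and three: "card (f ` set ws) = 3"
  shows "distinct ws"
proof (rule ccontr)
  have "ws \<noteq> []"
    using three by auto
  note hd_unique = colour_minimal_walk_hd[OF walk this]
    and last_unique = colour_minimal_walk_last[OF walk this]
  assume "\<not> distinct ws"
  then obtain xs y ys zs where ws: "ws = xs @ [y] @ ys @ [y] @ zs"
    using not_distinct_decomp by blast
  have "xs \<noteq> []"
  proof
    assume "xs = []"
    then have "hd ws = y" "y \<in> set (tl ws)"
      using ws by simp_all
    then show False
      using hd_unique by auto
  qed
  have "zs \<noteq> []"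
  proof
    assume "zs = []"
    then have "last ws = y" "y \<in> set (butlast ws)"
      using ws by (simp_all add: butlast_append)
    then show False
      using last_unique by auto
  qed
  define ws' where "ws' = xs @ [y] @ zs"
  have "successively R ws'"
    using colour_minimal_walkD(1)[OF walk] unfolding ws ws'_def by (rule successively_cut)
  moreover have "set ws' \<subseteq> set ws"
    unfolding ws ws'_def by auto
  moreover have "f ` set ws \<subseteq> f ` set ws'"
  proof -
    have "ws ! length xs = y" "0 < length xs" "length xs < length ws - 1"
      using \<open>xs \<noteq> []\<close> \<open>zs \<noteq> []\<close> unfolding ws by auto
    then have "f ` set ws = {f (hd ws), f y, f (last ws)}"
      using special_colours_image[OF colour_minimal_walk_special[OF walk three]] by metis
    moreover have "{hd ws, y, last ws} \<subseteq> set ws'"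
      using \<open>xs \<noteq> []\<close> \<open>zs \<noteq> []\<close> unfolding ws ws'_def by auto
    ultimately show ?thesis
      by auto
  qed
  ultimately have "length ws \<le> length ws'"
    by (rule colour_minimal_walkD(2)[OF walk])
  then show False
    unfolding ws ws'_def by simp
qed

lemma ex_special_subwalk:
  assumes walk: "successively R w" and three: "card (f ` set w) = 3"
  shows "\<exists>ws. successively R ws \<and> set ws \<subseteq> set w \<and> length ws \<le> length w \<and>
    distinct ws \<and> special_colours f ws"
proof -
  define walks where "walks = {ws. successively R ws \<and> set ws \<subseteq> set w \<and> f ` set w \<subseteq> f ` set ws}"
  have "w \<in> walks"
    using walk unfolding walks_def by blast
  then obtain ws where ws: "ws \<in> walks" and least: "\<And>ws'. ws' \<in> walks \<Longrightarrow> length ws \<le> length ws'"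
    using ex_has_least_nat[of "\<lambda>ws. ws \<in> walks" w length] by blast
  have ws_set: "set ws \<subseteq> set w" and ws_colours: "f ` set w \<subseteq> f ` set ws"
    using ws unfolding walks_def by simp_all
  have walk_ws: "colour_minimal_walk R f ws"
    unfolding colour_minimal_walk_def
  proof (intro conjI allI impI)
    show "successively R ws"
      using ws unfolding walks_def by simp
    fix ws' assume ws': "successively R ws' \<and> set ws' \<subseteq> set ws \<and> f ` set ws \<subseteq> f ` set ws'"
    then have "set ws' \<subseteq> set w" "f ` set w \<subseteq> f ` set ws'"
      using ws_set ws_colours by (meson subset_trans)+
    then have "ws' \<in> walks"
      using ws' unfolding walks_def by simp
    then show "length ws \<le> length ws'"
      by (rule least)
  qed
  have "f ` set ws = f ` set w"
    using ws_set ws_colours by blast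
  then have three_ws: "card (f ` set ws) = 3"
    using three by simp
  show ?thesis
  proof (intro exI conjI)
    show "successively R ws"
      using colour_minimal_walkD(1)[OF walk_ws] .
    show "set ws \<subseteq> set w"
      by (rule ws_set)
    show "length ws \<le> length w"
      using least[OF \<open>w \<in> walks\<close>] .
    show "distinct ws"
      using colour_minimal_walk_distinct[OF walk_ws three_ws] .
    show "special_colours f ws"
      using colour_minimal_walk_special[OF walk_ws three_ws] .
  qed
qed

section \<open>The exchange graph of a finite poset\<close>

lemma mem_exch_vertices: "S \<in> exch_vertices Q n \<longleftrightarrow> downset Q S \<and> card S = n"
  unfolding exch_vertices_def by simp

definition exch_walk :: "'a pos \<Rightarrow> nat \<Rightarrow> 'a set list \<Rightarrow> bool" where
  "exch_walk Q n ws \<longleftrightarrow> ws \<noteq> [] \<and> set ws \<subseteq> exch_vertices Q n \<and> successively exch_adj ws"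

lemma exch_path_iff_walk: "exch_path Q n ws \<longleftrightarrow> exch_walk Q n ws \<and> distinct ws"
  unfolding exch_path_def exch_walk_def successively_conv_nth by blast

lemma exch_adj_sym: "exch_adj S T \<Longrightarrow> exch_adj T S"
  unfolding exch_adj_def by simp

lemma exch_walk_rev: "exch_walk Q n ws \<Longrightarrow> exch_walk Q n (rev ws)"
  unfolding exch_walk_def by (auto intro: successively_mono exch_adj_sym)

lemma exch_walk_append:
  assumes "exch_walk Q n xs" "exch_walk Q n (y # ys)" "last xs = y"
  shows "exch_walk Q n (xs @ ys)"
proof -
  have "successively exch_adj (y # ys)" "set ys \<subseteq> exch_vertices Q n"
    using assms(2) unfolding exch_walk_def by auto
  then have "successively exch_adj (xs @ ys)"
    using assms(1,3) unfolding exch_walk_def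
    by (cases ys) (simp_all add: successively_append_iff)
  then show ?thesis
    using assms(1) \<open>set ys \<subseteq> _\<close> unfolding exch_walk_def by simp
qed

lemma finite_ex_minimal_rel:
  assumes "finite F" "F \<noteq> {}"
    and trans: "\<And>x y z. x \<in> F \<Longrightarrow> y \<in> F \<Longrightarrow> z \<in> F \<Longrightarrow> R x y \<Longrightarrow> R y z \<Longrightarrow> R x z"
    and antisym: "\<And>x y. x \<in> F \<Longrightarrow> y \<in> F \<Longrightarrow> R x y \<Longrightarrow> R y x \<Longrightarrow> x = y"
  shows "\<exists>t\<in>F. \<forall>z\<in>F. R z t \<longrightarrow> z = t"
proof -
  define below where "below t = {z \<in> F. R z t \<and> z \<noteq> t}" for t
  obtain t where t: "t \<in> F" and least: "\<And>u. u \<in> F \<Longrightarrow> card (below t) \<le> card (below u)"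
    using ex_has_least_nat[of "\<lambda>t. t \<in> F" _ "\<lambda>t. card (below t)"] assms(2) by blast
  have "z = t" if z: "z \<in> F" "R z t" for z
  proof (rule ccontr)
    assume "z \<noteq> t"
    then have "below z \<subset> below t"
      unfolding below_def using z t trans antisym by blast
    then have "card (below z) < card (below t)"
      using assms(1) by (simp add: below_def psubset_card_mono)
    then show False
      using least[OF z(1)] by simp
  qed
  then show ?thesis
    using t by blast
qed

definition maximal_in :: "'a pos \<Rightarrow> 'a set \<Rightarrow> 'a \<Rightarrow> bool" where
  "maximal_in Q F x \<longleftrightarrow> x \<in> F \<and> (\<forall>z\<in>F. snd Q x z \<longrightarrow> z = x)"

definition minimal_in :: "'a pos \<Rightarrow> 'a set \<Rightarrow> 'a \<Rightarrow> bool" where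
  "minimal_in Q F x \<longleftrightarrow> x \<in> F \<and> (\<forall>z\<in>F. snd Q z x \<longrightarrow> z = x)"

lemma maximal_in_subset: "maximal_in Q F x \<Longrightarrow> G \<subseteq> F \<Longrightarrow> x \<in> G \<Longrightarrow> maximal_in Q G x"
  unfolding maximal_in_def by blast

lemma minimal_in_subset: "minimal_in Q F x \<Longrightarrow> G \<subseteq> F \<Longrightarrow> x \<in> G \<Longrightarrow> minimal_in Q G x"
  unfolding minimal_in_def by blast

locale finite_poset =
  fixes Q :: "'a pos"
  assumes poset: "is_poset Q" and finite_carrier: "finite (fst Q)"
begin

lemma ex_minimal_in:
  assumes "F \<subseteq> fst Q" "F \<noteq> {}"
  shows "\<exists>x. minimal_in Q F x"
proof -
  have "finite F"
    using assms(1) finite_carrier by (rule finite_subset)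
  moreover have "snd Q x z" if "x \<in> F" "y \<in> F" "z \<in> F" "snd Q x y" "snd Q y z" for x y z
    using poset assms(1) that unfolding is_poset_def by blast
  moreover have "x = y" if "x \<in> F" "y \<in> F" "snd Q x y" "snd Q y x" for x y
    using poset assms(1) that unfolding is_poset_def by blast
  ultimately show ?thesis
    using finite_ex_minimal_rel[of F "snd Q"] assms(2) unfolding minimal_in_def by blast
qed

lemma ex_maximal_in:
  assumes "F \<subseteq> fst Q" "F \<noteq> {}"
  shows "\<exists>x. maximal_in Q F x"
proof -
  have "finite F"
    using assms(1) finite_carrier by (rule finite_subset)
  moreover have "snd Q z x" if "x \<in> F" "y \<in> F" "z \<in> F" "snd Q y x" "snd Q z y" for x y z
    using poset assms(1) that unfolding is_poset_def by blast
  moreover have "x = y" if "x \<in> F" "y \<in> F" "snd Q y x" "snd Q x y" for x y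
    using poset assms(1) that unfolding is_poset_def by blast
  ultimately show ?thesis
    using finite_ex_minimal_rel[of F "\<lambda>x y. snd Q y x"] assms(2) unfolding maximal_in_def by blast
qed

lemma ex_maximal_in_prefer:
  assumes "F \<subseteq> fst Q" "F \<noteq> {}" "maximal_in Q G a" "F \<subseteq> G"
  obtains q where "maximal_in Q F q" "a \<in> F \<Longrightarrow> q = a"
proof (cases "a \<in> F")
  case True
  then show ?thesis
    using that maximal_in_subset[OF assms(3,4) True] by blast
next
  case False
  then show ?thesis
    using that ex_maximal_in[OF assms(1,2)] by blast
qed

lemma ex_minimal_in_prefer:
  assumes "F \<subseteq> fst Q" "F \<noteq> {}" "minimal_in Q G b" "F \<subseteq> G"
  obtains j where "minimal_in Q F j" "b \<in> F \<Longrightarrow> j = b"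
proof (cases "b \<in> F")
  case True
  then show ?thesis
    using that minimal_in_subset[OF assms(3,4) True] by blast
next
  case False
  then show ?thesis
    using that ex_minimal_in[OF assms(1,2)] by blast
qed

lemma downset_swap:
  assumes S: "downset Q S" and T: "downset Q T"
    and s: "maximal_in Q (S - T) s" and t: "minimal_in Q (T - S) t"
  shows "downset Q (insert t (S - {s}))"
  unfolding downset_def
proof (intro conjI ballI impI)
  show "insert t (S - {s}) \<subseteq> fst Q"
    using S T t unfolding downset_def minimal_in_def by blast
  fix x y assume x: "x \<in> insert t (S - {s})" and y: "y \<in> fst Q" and yx: "snd Q y x"
  show "y \<in> insert t (S - {s})"
  proof (cases "x = t")
    case True
    then have "y \<in> T"
      using T t y yx unfolding downset_def minimal_in_def by blast
    then show ?thesis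
      using s t yx True unfolding maximal_in_def minimal_in_def by blast
  next
    case False
    then have "x \<in> S" "x \<noteq> s"
      using x by auto
    then have "y \<in> S" "x \<in> T \<longrightarrow> y \<in> T"
      using S T y yx unfolding downset_def by blast+
    then show ?thesis
      using s \<open>x \<in> S\<close> \<open>x \<noteq> s\<close> yx unfolding maximal_in_def by blast
  qed
qed

lemma swap_extremal:
  assumes "downset Q (insert t (S - {s}))" "S \<subseteq> fst Q" "s \<in> S" "t \<notin> S"
  shows "maximal_in Q S s" and "minimal_in Q (fst Q - S) t"
  using assms unfolding downset_def maximal_in_def minimal_in_def by blast+

lemma downset_remove_maximal:
  assumes D: "downset Q D" and L: "downset Q L" and s: "maximal_in Q (D - L) s"
  shows "downset Q (D - {s})"
  using assms unfolding downset_def maximal_in_def by blast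

lemma downset_shrink:
  assumes "downset Q L" "downset Q D0" "L \<subseteq> D0" "card L \<le> k" "k \<le> card D0"
  shows "\<exists>D. downset Q D \<and> L \<subseteq> D \<and> D \<subseteq> D0 \<and> card D = k"
  using assms(2-5)
proof (induction "card D0 - k" arbitrary: D0)
  case 0
  then show ?case
    by (intro exI[of _ D0]) auto
next
  case (Suc d)
  have "finite D0"
    using Suc.prems(1) finite_carrier finite_subset unfolding downset_def by blast
  have "D0 \<noteq> L"
    using Suc.hyps(2) Suc.prems(3) by auto
  then have "D0 - L \<noteq> {}"
    using Suc.prems(2) by blast
  moreover have "D0 - L \<subseteq> fst Q"
    using Suc.prems(1) unfolding downset_def by blast
  ultimately obtain s where s: "maximal_in Q (D0 - L) s"
    using ex_maximal_in by blast
  then have "s \<in> D0" "s \<notin> L"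
    unfolding maximal_in_def by auto
  have "card (D0 - {s}) = card D0 - 1"
    using \<open>s \<in> D0\<close> \<open>finite D0\<close> by simp
  then have "d = card (D0 - {s}) - k" "k \<le> card (D0 - {s})"
    using Suc.hyps(2) by simp_all
  moreover have "downset Q (D0 - {s})"
    using downset_remove_maximal[OF Suc.prems(1) assms(1) s] .
  moreover have "L \<subseteq> D0 - {s}"
    using Suc.prems(2) \<open>s \<notin> L\<close> by blast
  ultimately obtain D where "downset Q D" "L \<subseteq> D" "D \<subseteq> D0 - {s}" "card D = k"
    using Suc.hyps(1) Suc.prems(3) by blast
  then show ?case
    by blast
qed

lemma exch_vertex_subset: "S \<in> exch_vertices Q n \<Longrightarrow> S \<subseteq> fst Q"
  unfolding mem_exch_vertices downset_def by blast

lemma exch_vertex_finite: "S \<in> exch_vertices Q n \<Longrightarrow> finite S"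
  using exch_vertex_subset finite_carrier finite_subset by blast

lemma card_Diff_commute:
  assumes "S \<in> exch_vertices Q n" "T \<in> exch_vertices Q n"
  shows "card (S - T) = card (T - S)"
proof -
  have "card (S \<inter> T) + card (S - T) = card (T \<inter> S) + card (T - S)"
    using assms exch_vertex_finite card_Int_Diff unfolding mem_exch_vertices by metis
  then show ?thesis
    by (simp add: Int_commute)
qed

lemma swap_vertex:
  assumes S: "S \<in> exch_vertices Q n" and T: "T \<in> exch_vertices Q n"
    and s: "maximal_in Q (S - T) s" and t: "minimal_in Q (T - S) t"
  defines "U \<equiv> insert t (S - {s})"
  shows "U \<in> exch_vertices Q n" and "exch_adj S U" and "card (U - T) = card (S - T) - 1"
proof -
  have st: "s \<in> S" "s \<notin> T" "t \<in> T" "t \<notin> S"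
    using s t unfolding maximal_in_def minimal_in_def by auto
  have "finite S"
    using S by (rule exch_vertex_finite)
  have "downset Q U"
    unfolding U_def using S T s t downset_swap unfolding mem_exch_vertices by blast
  moreover have "card U = Suc (card (S - {s}))"
    unfolding U_def using st \<open>finite S\<close> by simp
  then have "card U = card S"
    using card_Suc_Diff1[OF \<open>finite S\<close> \<open>s \<in> S\<close>] by simp
  ultimately show "U \<in> exch_vertices Q n"
    using S by (simp add: mem_exch_vertices)
  have "S - U = {s}" "U - S = {t}"
    unfolding U_def using st by auto
  then show "exch_adj S U"
    unfolding exch_adj_def by simp
  have "U - T = (S - T) - {s}"
    unfolding U_def using st by auto
  then show "card (U - T) = card (S - T) - 1"
    using st \<open>finite S\<close> by simp
qed

lemma exchange_walk:
  assumes "S \<in> exch_vertices Q n" "T \<in> exch_vertices Q n"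
  shows "\<exists>ws. exch_walk Q n ws \<and> hd ws = S \<and> last ws = T \<and> length ws = Suc (card (S - T))"
  using assms
proof (induction "card (S - T)" arbitrary: S)
  case 0
  then have "S \<subseteq> T"
    using exch_vertex_finite by auto
  then have "S = T"
    using 0 exch_vertex_finite card_subset_eq unfolding mem_exch_vertices by metis
  then show ?case
    using 0 by (intro exI[of _ "[S]"]) (simp add: exch_walk_def)
next
  case (Suc d)
  have "S - T \<noteq> {}" "T - S \<noteq> {}"
    using Suc.hyps(2) card_Diff_commute[OF Suc.prems] by (metis card.empty nat.distinct(1))+
  moreover have "S - T \<subseteq> fst Q" "T - S \<subseteq> fst Q"
    using exch_vertex_subset Suc.prems by blast+
  ultimately obtain s t where s: "maximal_in Q (S - T) s" and t: "minimal_in Q (T - S) t"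
    using ex_maximal_in ex_minimal_in by metis
  define U where "U = insert t (S - {s})"
  have U: "U \<in> exch_vertices Q n" "exch_adj S U" "d = card (U - T)"
    using swap_vertex[OF Suc.prems s t] Suc.hyps(2) unfolding U_def by simp_all
  obtain ws where ws: "exch_walk Q n ws" "hd ws = U" "last ws = T" "length ws = Suc d"
    using Suc.hyps(1)[OF U(3) U(1) Suc.prems(2)] U(3) by blast
  have "exch_walk Q n (S # ws)"
    using ws(1,2) U(2) Suc.prems(1) unfolding exch_walk_def by (auto simp: successively_Cons)
  then show ?case
    using ws Suc.hyps(2) by (intro exI[of _ "S # ws"]) auto
qed

lemma walk_card_Diff_le:
  assumes walk: "exch_walk Q n ws" and "i \<le> j" "j < length ws"
  shows "card (ws ! i - ws ! j) \<le> j - i"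
  using assms(2,3)
proof (induction j)
  case 0
  then show ?case
    by simp
next
  case (Suc j)
  show ?case
  proof (cases "i = Suc j")
    case False
    then have "i \<le> j"
      using Suc.prems by simp
    have vertices: "ws ! k \<in> exch_vertices Q n" if "k < length ws" for k
      using walk that unfolding exch_walk_def by auto
    have "card (ws ! j - ws ! Suc j) = 1"
      using walk Suc.prems(2) successively_nth unfolding exch_walk_def exch_adj_def by blast
    moreover have "ws ! i \<in> exch_vertices Q n" "ws ! j \<in> exch_vertices Q n"
      using Suc.prems vertices \<open>i \<le> j\<close> by simp_all
    then have "card (ws ! i - ws ! Suc j) \<le> card (ws ! i - ws ! j) + card (ws ! j - ws ! Suc j)"
      using exch_vertex_finite card_Diff_triangle by blast
    ultimately show ?thesis
      using Suc.IH \<open>i \<le> j\<close> Suc.prems(2) by simp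
  qed simp
qed

(* The exchange step from S towards C; preferring alpha and beta puts it between v and C too. *)
lemma exchange_step_between:
  assumes S: "S \<in> exch_vertices Q n" and A: "A \<in> exch_vertices Q n" and C: "C \<in> exch_vertices Q n"
    and v: "v \<in> exch_vertices Q n" "v = insert \<beta> (A - {\<alpha>})" "\<alpha> \<in> A" "\<beta> \<notin> A"
    and common: "A \<inter> C \<subseteq> S" and ends: "S \<subseteq> A \<union> C" and "S - C \<noteq> {}"
  obtains U q j where "U = insert j (S - {q})" "q \<in> S - C" "j \<in> C - S" "U \<in> exch_vertices Q n"
    "card (S - C) = card (S - U) + card (U - C)" "card (v - C) = card (v - U) + card (U - C)"
proof -
  have "downset Q (insert \<beta> (A - {\<alpha>}))"
    using v(1,2) unfolding mem_exch_vertices by simp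
  note \<alpha>\<beta> = swap_extremal[OF this exch_vertex_subset[OF A] v(3,4)]
  have "0 < card (S - C)"
    using \<open>S - C \<noteq> {}\<close> exch_vertex_finite[OF S] by (simp add: card_gt_0_iff)
  then have "C - S \<noteq> {}"
    using card_Diff_commute[OF S C] by (metis card.empty less_irrefl)
  obtain q where q: "maximal_in Q (S - C) q" and q_pref: "\<alpha> \<in> S - C \<Longrightarrow> q = \<alpha>"
    using ex_maximal_in_prefer[OF _ \<open>S - C \<noteq> {}\<close> \<alpha>\<beta>(1)] exch_vertex_subset[OF S] ends by blast
  obtain j where j: "minimal_in Q (C - S) j" and j_pref: "\<beta> \<in> C - S \<Longrightarrow> j = \<beta>"
    using ex_minimal_in_prefer[OF _ \<open>C - S \<noteq> {}\<close> \<alpha>\<beta>(2)] exch_vertex_subset[OF C] common by blast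
  define U where "U = insert j (S - {q})"
  have U: "U \<in> exch_vertices Q n"
    unfolding U_def using swap_vertex(1)[OF S C q j] .
  have qj: "q \<in> S - C" "j \<in> C - S"
    using q j unfolding maximal_in_def minimal_in_def by auto
  then have "S \<inter> C \<subseteq> U" "U \<subseteq> S \<union> C"
    unfolding U_def by auto
  then have "card (S - C) = card (S - U) + card (U - C)"
    using exch_vertex_finite[OF S] exch_vertex_finite[OF U] by (rule card_Diff_between)
  moreover have "v \<inter> C \<subseteq> U" "U \<subseteq> v \<union> C"
    unfolding U_def v(2) using swap_between[OF common ends qj q_pref j_pref] by blast+
  then have "card (v - C) = card (v - U) + card (U - C)"
    using exch_vertex_finite[OF v(1)] exch_vertex_finite[OF U] by (rule card_Diff_between)
  ultimately show ?thesis
    using that U_def qj U by blast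
qed

lemma ex_downset_above_common:
  assumes S: "S \<in> exch_vertices Q n" and A: "A \<in> exch_vertices Q n" and C: "C \<in> exch_vertices Q n"
    and ends: "S \<subseteq> A \<union> C" and misses: "\<not> C - A \<subseteq> S"
  obtains D where "downset Q D" "A \<inter> C \<subseteq> D" "D \<subseteq> A \<inter> C \<union> (S - C)" "card D + card (S - A) = card A"
proof -
  let ?X = "A \<inter> C" and ?m = "card (A - C)"
  have fin: "finite A" "finite C" "finite S"
    using A C S exch_vertex_finite by blast+
  have "S - A \<subset> C - A"
    using ends misses by blast
  then have "card (S - A) < ?m"
    using fin card_Diff_commute[OF A C] psubset_card_mono[of "C - A"] by simp
  have "card S = card A"
    using S A by (simp add: mem_exch_vertices)
  then have "?m \<le> card (S - C) + card (S - A)"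
    using card_Diff_le_add[OF fin(1,3) _ ends] by blast
  have "downset Q ?X"
    using A C unfolding mem_exch_vertices downset_def by blast
  moreover have "?X \<union> (S - C) = ?X \<union> (S \<inter> A)"
    using ends by blast
  then have "downset Q (?X \<union> (S - C))"
    using A C S unfolding mem_exch_vertices downset_def by auto
  moreover have "card (?X \<union> (S - C)) = card ?X + card (S - C)"
    using fin by (intro card_Un_disjoint) auto
  then have "card ?X + (?m - card (S - A)) \<le> card (?X \<union> (S - C))"
    using \<open>?m \<le> card (S - C) + card (S - A)\<close> by linarith
  ultimately obtain D where D: "downset Q D" "?X \<subseteq> D" "D \<subseteq> ?X \<union> (S - C)"
    "card D = card ?X + (?m - card (S - A))"
    using downset_shrink[OF _ _ Un_upper1 le_add1] by blast
  moreover have "card A = card ?X + ?m"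
    using card_Int_Diff[OF fin(1)] by simp
  ultimately show ?thesis
    using that \<open>card (S - A) < ?m\<close> by simp
qed

lemma ex_vertex_between:
  assumes S: "S \<in> exch_vertices Q n" and A: "A \<in> exch_vertices Q n" and C: "C \<in> exch_vertices Q n"
    and ends: "S \<subseteq> A \<union> C" and misses: "\<not> A - C \<subseteq> S" "\<not> C - A \<subseteq> S"
  obtains y where "y \<in> exch_vertices Q n" "A \<inter> C \<subseteq> y" "S \<inter> C \<subseteq> y" "y \<subseteq> S \<union> C"
    "\<not> A - C \<subseteq> y" "\<not> C - A \<subseteq> y"
proof -
  obtain D where D: "downset Q D" "A \<inter> C \<subseteq> D" "D \<subseteq> A \<inter> C \<union> (S - C)"
    "card D + card (S - A) = card A"
    using ex_downset_above_common[OF S A C ends misses(2)] by blast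
  define y where "y = D \<union> (S \<inter> C)"
  have "y = D \<union> (S - A)" "D \<inter> (S - A) = {}"
    unfolding y_def using D(2,3) ends by blast+
  moreover have "finite A" "finite S"
    using exch_vertex_finite A S by blast+
  then have "finite D" "finite (S - A)"
    using finite_subset[OF D(3)] by simp_all
  ultimately have "card y = card D + card (S - A)"
    by (simp add: card_Un_disjoint)
  moreover have "downset Q y"
    unfolding y_def using D(1) S C unfolding mem_exch_vertices downset_def by blast
  ultimately have "y \<in> exch_vertices Q n"
    using A D(4) unfolding mem_exch_vertices by simp
  moreover have "A \<inter> C \<subseteq> y" "S \<inter> C \<subseteq> y" "y \<subseteq> S \<union> C" "\<not> A - C \<subseteq> y" "\<not> C - A \<subseteq> y"
    using D(2,3) misses unfolding y_def by blast+
  ultimately show ?thesis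
    using that by blast
qed

end

section \<open>Shortest special paths\<close>

(* The isomorphism type of a downset is abstracted to an arbitrary colouring col. *)
locale shortest_special_path = finite_poset Q for Q :: "'a pos" +
  fixes n :: nat and col :: "'a set \<Rightarrow> 'c" and vs :: "'a set list"
  assumes path: "exch_path Q n vs"
    and special: "special_colours col vs"
    and three_colours: "S \<in> exch_vertices Q n \<Longrightarrow> col S \<in> col ` set vs"
    and shortest: "\<And>ws. exch_path Q n ws \<Longrightarrow> special_colours col ws \<Longrightarrow> length vs \<le> length ws"
    and carrier: "fst Q = \<Union> (set vs)"
    and wide: "3 \<le> card (hd vs - last vs)"
begin

lemma path_walk: "exch_walk Q n vs"
  using path exch_path_iff_walk by blast

lemma length_ge_3: "3 \<le> length vs"
  using special unfolding special_colours_def by blast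

lemma path_ne: "vs \<noteq> []"
  using length_ge_3 by auto

lemma path_vertex: "i < length vs \<Longrightarrow> vs ! i \<in> exch_vertices Q n"
  using path_walk unfolding exch_walk_def by auto

lemma end_vertices: "hd vs \<in> exch_vertices Q n" "last vs \<in> exch_vertices Q n"
  using path_walk unfolding exch_walk_def by auto

lemma second_vertex: "vs ! 1 \<in> exch_vertices Q n"
  using path_vertex length_ge_3 by simp

lemma colours_distinct:
  "col (hd vs) \<noteq> col (vs ! 1)" "col (vs ! 1) \<noteq> col (last vs)" "col (hd vs) \<noteq> col (last vs)"
  using special unfolding special_colours_def by blast+

lemma inner_colour: "0 < i \<Longrightarrow> i < length vs - 1 \<Longrightarrow> col (vs ! i) = col (vs ! 1)"
  using special unfolding special_colours_def by blast

lemma colours_of_path: "col ` set vs = {col (hd vs), col (vs ! 1), col (last vs)}"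
  using special_colours_image[OF special, of 1] length_ge_3 by simp

lemma colour_cases:
  assumes "S \<in> exch_vertices Q n"
  obtains "col S = col (hd vs)" | "col S = col (vs ! 1)" | "col S = col (last vs)"
  using three_colours[OF assms] colours_of_path by blast

lemma three_colour_bound:
  assumes S: "S1 \<in> exch_vertices Q n" "S2 \<in> exch_vertices Q n" "S3 \<in> exch_vertices Q n"
    and distinct: "col S1 \<noteq> col S2" "col S2 \<noteq> col S3" "col S1 \<noteq> col S3"
  shows "length vs - 1 \<le> card (S1 - S2) + card (S2 - S3)"
proof -
  obtain w1 where w1: "exch_walk Q n w1" "hd w1 = S1" "last w1 = S2"
      "length w1 = Suc (card (S1 - S2))"
    using exchange_walk[OF S(1,2)] by blast
  obtain w2 where w2: "exch_walk Q n w2" "hd w2 = S2" "last w2 = S3"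
      "length w2 = Suc (card (S2 - S3))"
    using exchange_walk[OF S(2,3)] by blast
  have "S2 \<noteq> S3"
    using distinct by auto
  then obtain ys where ys: "w2 = S2 # ys" "ys \<noteq> []" "last ys = S3"
    using w2 unfolding exch_walk_def by (metis last.simps list.collapse)
  define w where "w = w1 @ ys"
  have w: "exch_walk Q n w"
    unfolding w_def using exch_walk_append w1 w2 ys by metis
  have sub: "{col S1, col S2, col S3} \<subseteq> col ` set w"
    using w1 ys unfolding w_def exch_walk_def by (auto simp: hd_in_set last_in_set)
  have "col ` set w \<subseteq> col ` set vs"
    using w three_colours unfolding exch_walk_def by blast
  have "{col S1, col S2, col S3} = col ` set vs"
  proof (rule card_subset_eq)
    show "{col S1, col S2, col S3} \<subseteq> col ` set vs"
      using sub \<open>col ` set w \<subseteq> col ` set vs\<close> by (rule subset_trans)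
    show "card {col S1, col S2, col S3} = card (col ` set vs)"
      unfolding colours_of_path using distinct colours_distinct by simp
  qed simp
  then have "col ` set w = {col S1, col S2, col S3}"
    using sub \<open>col ` set w \<subseteq> col ` set vs\<close> by blast
  then have "card (col ` set w) = 3"
    using distinct by simp
  then obtain ws where ws: "successively exch_adj ws" "set ws \<subseteq> set w" "length ws \<le> length w"
      "distinct ws" "special_colours col ws"
    using ex_special_subwalk w unfolding exch_walk_def by blast
  have "ws \<noteq> []"
    using special_colours_length[OF ws(5)] by auto
  then have "exch_path Q n ws"
    using w ws unfolding exch_path_iff_walk exch_walk_def by auto
  then have "length vs \<le> length ws"
    using shortest ws(5) by blast
  then show ?thesis
    using ws(3) w1 w2 ys unfolding w_def by simp
qed

lemma path_card_Diff_le: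
  assumes "i \<le> j" "j < length vs"
  shows "card (vs ! i - vs ! j) \<le> j - i" and "card (vs ! j - vs ! i) \<le> j - i"
proof -
  show "card (vs ! i - vs ! j) \<le> j - i"
    using walk_card_Diff_le[OF path_walk assms] .
  then show "card (vs ! j - vs ! i) \<le> j - i"
    using card_Diff_commute path_vertex assms by (metis le_less_trans)
qed

lemma hd_last_conv_nth: "hd vs = vs ! 0" "last vs = vs ! (length vs - 1)"
  using path_ne by (simp_all add: hd_conv_nth last_conv_nth)

lemma wide_le_length: "card (hd vs - last vs) \<le> length vs - 1"
  using path_card_Diff_le(1)[of 0 "length vs - 1"] path_ne unfolding hd_last_conv_nth by simp

(* Reversal swaps the two ends, giving the symmetric half of every argument. *)
lemma reversed: "shortest_special_path Q n col (rev vs)"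
proof unfold_locales
  show "exch_path Q n (rev vs)"
    using path exch_walk_rev[of Q n vs] unfolding exch_path_iff_walk by simp
  show "special_colours col (rev vs)"
    using special by (rule special_colours_rev)
  show "col S \<in> col ` set (rev vs)" if "S \<in> exch_vertices Q n" for S
    using three_colours that by simp
  show "length (rev vs) \<le> length ws" if "exch_path Q n ws" "special_colours col ws" for ws
    using shortest that by simp
  show "fst Q = \<Union> (set (rev vs))"
    using carrier by simp
  show "3 \<le> card (hd (rev vs) - last (rev vs))"
    using wide card_Diff_commute[OF end_vertices] path_ne by (simp add: hd_rev last_rev)
qed

(* Whichever colour U has, one of the three triples below is coloured with three colours. *)
lemma no_close_vertex:
  assumes U: "U \<in> exch_vertices Q n" and Y: "Y \<in> exch_vertices Q n" "col Y = col (hd vs)"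
    and close_Y: "card (Y - U) + card (U - last vs) < length vs - 1"
    and close_second: "card (vs ! 1 - U) + card (U - last vs) < length vs - 1"
    and close_first: "card (U - vs ! 1) + card (vs ! 1 - hd vs) < length vs - 1"
  shows False
  using U
proof (cases rule: colour_cases)
  case 1
  then have "length vs - 1 \<le> card (vs ! 1 - U) + card (U - last vs)"
    using three_colour_bound[OF second_vertex U end_vertices(2)] colours_distinct by simp
  then show False
    using close_second by simp
next
  case 2
  then have "length vs - 1 \<le> card (Y - U) + card (U - last vs)"
    using three_colour_bound[OF Y(1) U end_vertices(2)] Y(2) colours_distinct by simp
  then show False
    using close_Y by simp
next
  case 3
  then have "length vs - 1 \<le> card (U - vs ! 1) + card (vs ! 1 - hd vs)"
    using three_colour_bound[OF U second_vertex end_vertices(1)] colours_distinct by simp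
  then show False
    using close_first by simp
qed

lemma first_edge: "exch_adj (hd vs) (vs ! 1)"
  using path_walk length_ge_3 successively_nth[of exch_adj vs 0] unfolding exch_walk_def hd_last_conv_nth
  by simp

lemma last_edge: "card (last vs - vs ! (length vs - 2)) = 1"
proof -
  have "exch_adj (vs ! (length vs - 2)) (vs ! Suc (length vs - 2))"
    using path_walk length_ge_3 successively_nth[of exch_adj vs "length vs - 2"]
    unfolding exch_walk_def by simp
  moreover have "Suc (length vs - 2) = length vs - 1"
    using length_ge_3 by simp
  ultimately show ?thesis
    unfolding exch_adj_def hd_last_conv_nth by simp
qed

lemma first_exchange_step:
  obtains U p j where "U = insert j (hd vs - {p})" "p \<in> hd vs - last vs" "j \<in> last vs - hd vs"
    "U \<in> exch_vertices Q n" "card (U - last vs) = card (hd vs - last vs) - 1"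
    "card (vs ! 1 - last vs) = card (vs ! 1 - U) + card (U - last vs)"
proof -
  let ?A = "hd vs" and ?C = "last vs" and ?v = "vs ! 1"
  obtain \<alpha> \<beta> where "?A - ?v = {\<alpha>}" "?v - ?A = {\<beta>}"
    using first_edge unfolding exch_adj_def by (meson card_1_singletonE)
  then have v: "?v = insert \<beta> (?A - {\<alpha>})" "\<alpha> \<in> ?A" "\<beta> \<notin> ?A"
    by blast+
  have A_minus_C: "?A - ?C \<noteq> {}"
    using wide by (metis card.empty not_numeral_le_zero)
  obtain U p j where U: "U = insert j (?A - {p})" "p \<in> ?A - ?C" "j \<in> ?C - ?A"
    "U \<in> exch_vertices Q n" "card (?A - ?C) = card (?A - U) + card (U - ?C)"
    "card (?v - ?C) = card (?v - U) + card (U - ?C)"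
    by (rule exchange_step_between[OF end_vertices(1,1,2) second_vertex v Int_lower1 Un_upper1 A_minus_C])
  moreover have "U - ?C = (?A - ?C) - {p}"
    using U by auto
  then have "card (U - ?C) = card (?A - ?C) - 1"
    using U exch_vertex_finite[OF end_vertices(1)] by simp
  ultimately show ?thesis
    using that by blast
qed

lemma length_eq_wide: "length vs - 1 = card (hd vs - last vs)"
proof (rule ccontr)
  let ?A = "hd vs" and ?C = "last vs" and ?v = "vs ! 1"
  assume "length vs - 1 \<noteq> card (?A - ?C)"
  then have wider: "card (?A - ?C) < length vs - 1"
    using wide_le_length by simp
  obtain U p j where U: "U = insert j (?A - {p})" "p \<in> ?A - ?C" "j \<in> ?C - ?A"
    "U \<in> exch_vertices Q n" "card (U - ?C) = card (?A - ?C) - 1"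
    "card (?v - ?C) = card (?v - U) + card (U - ?C)"
    by (rule first_exchange_step)
  have "card (?v - ?C) \<le> length vs - 1 - 1"
    using path_card_Diff_le(1)[of 1 "length vs - 1"] length_ge_3 unfolding hd_last_conv_nth by simp
  moreover have "?A - U = {p}"
    using U(1-3) by auto
  then have "card (?A - U) = 1"
    by simp
  moreover have "card (U - ?v) = card (?v - U)" "card (?v - ?A) = 1"
    using card_Diff_commute[OF U(4) second_vertex] first_edge unfolding exch_adj_def by simp_all
  ultimately show False
    using no_close_vertex[OF U(4) end_vertices(1) refl] U(5,6) wider wide by linarith
qed

lemma second_vertex_eq: "\<exists>p j. p \<in> hd vs - last vs \<and> j \<in> last vs - hd vs \<and> vs ! 1 = insert j (hd vs - {p})"
proof -
  let ?A = "hd vs" and ?C = "last vs" and ?v = "vs ! 1"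
  obtain U p j where U: "U = insert j (?A - {p})" "p \<in> ?A - ?C" "j \<in> ?C - ?A"
    "U \<in> exch_vertices Q n" "card (U - ?C) = card (?A - ?C) - 1"
    "card (?v - ?C) = card (?v - U) + card (U - ?C)"
    by (rule first_exchange_step)
  have "card (?v - ?C) \<le> length vs - 1 - 1"
    using path_card_Diff_le(1)[of 1 "length vs - 1"] length_ge_3 unfolding hd_last_conv_nth by simp
  then have "card (?v - U) = 0"
    using U(5,6) length_eq_wide wide by linarith
  then have "?v \<subseteq> U"
    using exch_vertex_finite[OF second_vertex] by simp
  then have "?v = U"
    by (rule card_subset_eq[OF exch_vertex_finite[OF U(4)]])
      (use U(4) second_vertex in \<open>simp add: mem_exch_vertices\<close>)
  then show ?thesis
    using U(1-3) by blast
qed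

lemma carrier_ends: "fst Q = hd vs \<union> last vs"
proof
  show "hd vs \<union> last vs \<subseteq> fst Q"
    using exch_vertex_subset end_vertices by blast
  show "fst Q \<subseteq> hd vs \<union> last vs"
  proof
    fix x assume "x \<in> fst Q"
    then obtain i where i: "i < length vs" "x \<in> vs ! i"
      using carrier by (metis UnionE in_set_conv_nth)
    let ?T = "vs ! i"
    have "card (?T - hd vs) \<le> i"
      using path_card_Diff_le(2)[of 0 i] i(1) unfolding hd_last_conv_nth by simp
    moreover have "card (?T - last vs) \<le> length vs - 1 - i"
      using path_card_Diff_le(1)[of i "length vs - 1"] i(1) unfolding hd_last_conv_nth by simp
    moreover have "card (hd vs - last vs) + card (?T - (hd vs \<union> last vs))
        \<le> card (?T - hd vs) + card (?T - last vs)"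
      using path_vertex[OF i(1)] end_vertices exch_vertex_finite
      by (intro card_Diff_Un_le) (simp_all add: mem_exch_vertices)
    ultimately have "card (?T - (hd vs \<union> last vs)) = 0"
      using length_eq_wide i(1) by linarith
    then have "?T \<subseteq> hd vs \<union> last vs"
      using exch_vertex_finite[OF path_vertex[OF i(1)]] by simp
    then show "x \<in> hd vs \<union> last vs"
      using i(2) by blast
  qed
qed

lemma card_Diff_last_if_first_colour:
  assumes S: "S \<in> exch_vertices Q n" and misses: "\<not> hd vs - last vs \<subseteq> S"
    and colour: "col S = col (hd vs)"
  shows "card (S - last vs) = card (hd vs - last vs) - 1"
proof -
  let ?u = "vs ! (length vs - 2)"
  note r_eq = length_eq_wide
  have u: "?u \<in> exch_vertices Q n" "col ?u = col (vs ! 1)"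
    using path_vertex inner_colour[of "length vs - 2"] wide r_eq by simp_all
  have "length vs - 1 \<le> card (S - last vs) + card (last vs - ?u)"
    using three_colour_bound[OF S end_vertices(2) u(1)] colour u(2) colours_distinct by simp
  moreover have "S - last vs \<subset> hd vs - last vs"
    using exch_vertex_subset[OF S] carrier_ends misses by blast
  then have "card (S - last vs) < card (hd vs - last vs)"
    using exch_vertex_finite[OF end_vertices(1)] by (intro psubset_card_mono) auto
  ultimately show ?thesis
    using last_edge r_eq by linarith
qed

lemma first_colour_excluded_above_common:
  assumes S: "S \<in> exch_vertices Q n" and common: "hd vs \<inter> last vs \<subseteq> S"
    and misses: "\<not> hd vs - last vs \<subseteq> S" and colour: "col S = col (hd vs)"
  shows False
proof -
  let ?A = "hd vs" and ?C = "last vs" and ?v = "vs ! 1" and ?m = "card (hd vs - last vs)"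
  obtain p1 j1 where p1: "p1 \<in> ?A - ?C" and j1: "j1 \<in> ?C - ?A" and v_eq: "?v = insert j1 (?A - {p1})"
    using second_vertex_eq by blast
  have dist_S_C: "card (S - ?C) = ?m - 1"
    using card_Diff_last_if_first_colour[OF S misses colour] .
  then have "0 < card (S - ?C)"
    using wide by simp
  then have S_minus_C: "S - ?C \<noteq> {}"
    using card_gt_0_iff by blast
  have ends: "S \<subseteq> ?A \<union> ?C"
    using exch_vertex_subset[OF S] carrier_ends by blast
  have p1_j1: "p1 \<in> ?A" "j1 \<notin> ?A"
    using p1 j1 by auto
  obtain U q j where U: "U = insert j (S - {q})" "q \<in> S - ?C" "j \<in> ?C - S"
    "U \<in> exch_vertices Q n" "card (S - ?C) = card (S - U) + card (U - ?C)"
    "card (?v - ?C) = card (?v - U) + card (U - ?C)"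
    by (rule exchange_step_between[OF S end_vertices second_vertex v_eq p1_j1 common ends S_minus_C])
  have "U - ?C = (S - ?C) - {q}"
    using U(1-3) by auto
  then have "card (U - ?C) = ?m - 2"
    using U(2) dist_S_C exch_vertex_finite[OF S] by simp
  moreover have "?v - ?C = (?A - ?C) - {p1}" "?v - ?A = {j1}"
    using v_eq p1 j1 by auto
  then have "card (?v - ?C) = ?m - 1" "card (?v - ?A) = 1"
    using p1 exch_vertex_finite[OF end_vertices(1)] by simp_all
  moreover have "card (U - ?v) = card (?v - U)"
    using card_Diff_commute[OF U(4) second_vertex] .
  ultimately show False
    using no_close_vertex[OF U(4) S colour] dist_S_C U(5,6) length_eq_wide wide by linarith
qed

lemma second_colour_above_common:
  assumes S: "S \<in> exch_vertices Q n" and common: "hd vs \<inter> last vs \<subseteq> S"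
    and "\<not> hd vs - last vs \<subseteq> S" "\<not> last vs - hd vs \<subseteq> S"
  shows "col S = col (vs ! 1)"
proof -
  interpret rev: shortest_special_path Q n col "rev vs"
    by (rule reversed)
  have "col S \<noteq> col (hd vs)"
    using first_colour_excluded_above_common assms by blast
  moreover have "col S \<noteq> col (last vs)"
    using rev.first_colour_excluded_above_common[OF S] assms path_ne
    by (auto simp: hd_rev last_rev)
  ultimately show ?thesis
    using colour_cases[OF S] by metis
qed

lemma first_colour_excluded:
  assumes S: "S \<in> exch_vertices Q n" and misses: "\<not> hd vs - last vs \<subseteq> S" "\<not> last vs - hd vs \<subseteq> S"
    and colour: "col S = col (hd vs)"
  shows False
proof -
  have ends: "S \<subseteq> hd vs \<union> last vs"
    using exch_vertex_subset[OF S] carrier_ends by blast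
  obtain y where y: "y \<in> exch_vertices Q n" "hd vs \<inter> last vs \<subseteq> y"
    and between: "S \<inter> last vs \<subseteq> y" "y \<subseteq> S \<union> last vs"
    and y_misses: "\<not> hd vs - last vs \<subseteq> y" "\<not> last vs - hd vs \<subseteq> y"
    using ex_vertex_between[OF S end_vertices ends misses] .
  have "col y = col (vs ! 1)"
    using second_colour_above_common[OF y y_misses] .
  then have "length vs - 1 \<le> card (S - y) + card (y - last vs)"
    using three_colour_bound[OF S y(1) end_vertices(2)] colour colours_distinct by simp
  also have "\<dots> = card (S - last vs)"
    using between exch_vertex_finite[OF S] exch_vertex_finite[OF y(1)] by (intro card_Diff_between[symmetric])
  also have "\<dots> < card (hd vs - last vs)"
    using ends misses(1) exch_vertex_finite[OF end_vertices(1)] by (intro psubset_card_mono) auto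
  finally show False
    using length_eq_wide by linarith
qed

theorem second_colour_if_misses_both_ends:
  assumes S: "S \<in> exch_vertices Q n"
    and "\<not> hd vs - last vs \<subseteq> S" "\<not> last vs - hd vs \<subseteq> S"
  shows "col S = col (vs ! 1)"
proof -
  interpret rev: shortest_special_path Q n col "rev vs"
    by (rule reversed)
  have "col S \<noteq> col (hd vs)"
    using first_colour_excluded assms by blast
  moreover have "col S \<noteq> col (last vs)"
    using rev.first_colour_excluded[OF S] assms path_ne by (auto simp: hd_rev last_rev)
  ultimately show ?thesis
    using colour_cases[OF S] by metis
qed

end

section \<open>Isomorphism types\<close>

definition pairwise_non_iso :: "'b pos set \<Rightarrow> bool" where
  "pairwise_non_iso Gam \<longleftrightarrow> (\<forall>T1\<in>Gam. \<forall>T2\<in>Gam. pos_iso T1 T2 \<longrightarrow> T1 = T2)"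

definition iso_type :: "'a pos \<Rightarrow> 'b pos set \<Rightarrow> 'a set \<Rightarrow> 'b pos" where
  "iso_type Q Gam S = (SOME T. T \<in> Gam \<and> pos_iso (subpos Q S) T)"

lemma iso_type_in_iso:
  assumes "witness Q n Gam" "S \<in> exch_vertices Q n"
  shows "iso_type Q Gam S \<in> Gam" and "pos_iso (subpos Q S) (iso_type Q Gam S)"
proof -
  have "\<exists>T. T \<in> Gam \<and> pos_iso (subpos Q S) T"
    using assms unfolding witness_def by blast
  then have "iso_type Q Gam S \<in> Gam \<and> pos_iso (subpos Q S) (iso_type Q Gam S)"
    unfolding iso_type_def by (rule someI_ex)
  then show "iso_type Q Gam S \<in> Gam" "pos_iso (subpos Q S) (iso_type Q Gam S)"
    by blast+
qed

lemma iso_type_eq: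
  assumes "witness Q n Gam" "pairwise_non_iso Gam" "S \<in> exch_vertices Q n"
    and "T \<in> Gam" "pos_iso (subpos Q S) T"
  shows "iso_type Q Gam S = T"
  using assms iso_type_in_iso[OF assms(1,3)] pos_iso_sym pos_iso_trans
  unfolding pairwise_non_iso_def by metis

lemma special_path_if_special_colours:
  assumes wit: "witness Q n Gam" and path: "exch_path Q n ws"
    and special: "special_colours (iso_type Q Gam) ws"
  shows "special_path Q n Gam ws"
proof -
  let ?t = "iso_type Q Gam"
  have len: "3 \<le> length ws"
    and distinct: "?t (hd ws) \<noteq> ?t (ws ! 1)" "?t (ws ! 1) \<noteq> ?t (last ws)" "?t (hd ws) \<noteq> ?t (last ws)"
    and inner: "\<And>i. 0 < i \<Longrightarrow> i < length ws - 1 \<Longrightarrow> ?t (ws ! i) = ?t (ws ! 1)"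
    using special unfolding special_colours_def by blast+
  have vertex: "S \<in> exch_vertices Q n" if "S \<in> set ws" for S
    using path that unfolding exch_path_def by blast
  have "ws \<noteq> []"
    using len by auto
  then have "hd ws \<in> set ws" "last ws \<in> set ws" "ws ! 1 \<in> set ws"
    using len by simp_all
  note ends = this[THEN vertex, THEN iso_type_in_iso(1)[OF wit]]
    this[THEN vertex, THEN iso_type_in_iso(2)[OF wit]]
  have "pos_iso (subpos Q (ws ! i)) (?t (ws ! 1))" if "0 < i" "i < length ws - 1" for i
  proof -
    have "i < length ws"
      using that by simp
    then show ?thesis
      using iso_type_in_iso(2)[OF wit vertex[OF nth_mem]] inner[OF that] by metis
  qed
  then show ?thesis
    unfolding special_path_def using path len distinct ends by blast
qed

lemma shortest_special_path_iso_type: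
  assumes poset: "is_poset Q" "finite (fst Q)"
    and wit: "witness Q n {A, B, C}" and rigid: "pairwise_non_iso {A, B, C}"
    and distinct: "A \<noteq> B" "B \<noteq> C" "A \<noteq> C"
    and sp: "special_path Q n {A, B, C} vs"
    and minimal: "\<forall>ws. special_path Q n {A, B, C} ws \<longrightarrow> length vs \<le> length ws"
    and v0: "pos_iso (subpos Q (hd vs)) A"
    and vint: "\<forall>i. 0 < i \<and> i < length vs - 1 \<longrightarrow> pos_iso (subpos Q (vs ! i)) B"
    and vr: "pos_iso (subpos Q (last vs)) C"
    and carrier: "fst Q = \<Union> (set vs)" and wide: "3 \<le> card (hd vs - last vs)"
  shows "shortest_special_path Q n (iso_type Q {A, B, C}) vs"
proof -
  let ?t = "iso_type Q {A, B, C}"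
  have path: "exch_path Q n vs" and len: "3 \<le> length vs"
    using sp unfolding special_path_def by blast+
  have vertex: "S \<in> exch_vertices Q n" if "S \<in> set vs" for S
    using path that unfolding exch_path_def by blast
  have "vs \<noteq> []"
    using len by auto
  then have "hd vs \<in> set vs" "last vs \<in> set vs" "vs ! 1 \<in> set vs"
    using len by simp_all
  have types: "?t (hd vs) = A" "?t (last vs) = C"
    using iso_type_eq[OF wit rigid] vertex v0 vr \<open>hd vs \<in> set vs\<close> \<open>last vs \<in> set vs\<close>
    by simp_all
  have inner_type: "?t (vs ! i) = B" if "0 < i" "i < length vs - 1" for i
    using iso_type_eq[OF wit rigid vertex[OF nth_mem]] vint that by simp
  have "?t (hd vs) \<in> ?t ` set vs" "?t (vs ! 1) \<in> ?t ` set vs" "?t (last vs) \<in> ?t ` set vs"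
    using \<open>hd vs \<in> set vs\<close> \<open>vs ! 1 \<in> set vs\<close> \<open>last vs \<in> set vs\<close> by simp_all
  moreover have "?t (vs ! 1) = B"
    using inner_type len by simp
  ultimately have all_types: "{A, B, C} \<subseteq> ?t ` set vs"
    using types by simp
  show ?thesis
  proof
    show "special_colours ?t vs"
      unfolding special_colours_def using len types inner_type distinct by simp
    show "?t S \<in> ?t ` set vs" if "S \<in> exch_vertices Q n" for S
      using iso_type_in_iso(1)[OF wit that] all_types by blast
    show "length vs \<le> length ws" if "exch_path Q n ws" "special_colours ?t ws" for ws
      using minimal special_path_if_special_colours[OF wit that] by blast
  qed (use poset path carrier wide in simp_all)
qed

theorem mainTheorem15:
  fixes Q :: "'a pos" and A B C :: "'b pos" and n :: nat and vs :: "'a set list"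
    and X :: "'a set" and m :: nat
  assumes posA: "is_poset A" and posB: "is_poset B" and posC: "is_poset C"
    and finA: "finite (fst A)" and finB: "finite (fst B)" and finC: "finite (fst C)"
    and cardA: "card (fst A) = n" and cardB: "card (fst B) = n" and cardC: "card (fst C) = n"
    and nAB: "\<not> pos_iso A B" and nAC: "\<not> pos_iso A C" and nBC: "\<not> pos_iso B C"
    and posQ: "is_poset Q" and finQ: "finite (fst Q)"
    and wit: "witness Q n {A, B, C}"
    and sp: "special_path Q n {A, B, C} vs"
    and minimal: "\<forall>ws. special_path Q n {A, B, C} ws \<longrightarrow> length vs \<le> length ws"
    and v0: "pos_iso (subpos Q (hd vs)) A"
    and vint: "\<forall>i. 0 < i \<and> i < length vs - 1 \<longrightarrow> pos_iso (subpos Q (vs ! i)) B"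
    and vr: "pos_iso (subpos Q (last vs)) C"
    and Qunion: "fst Q = \<Union> (set vs)"
    and X_def: "X = hd vs \<inter> last vs"
    and m_def: "m = card (hd vs - X)"
    and m3: "m \<ge> 3"
  shows "\<forall>S. downset Q S \<and> card S = n \<and> \<not> (hd vs - X \<subseteq> S) \<and> \<not> (last vs - X \<subseteq> S)
           \<longrightarrow> pos_iso (subpos Q S) B"
proof (intro allI impI)
  fix S assume S: "downset Q S \<and> card S = n \<and> \<not> (hd vs - X \<subseteq> S) \<and> \<not> (last vs - X \<subseteq> S)"
  have rigid: "pairwise_non_iso {A, B, C}"
    using nAB nAC nBC pos_iso_sym unfolding pairwise_non_iso_def by blast
  have distinct: "A \<noteq> B" "B \<noteq> C" "A \<noteq> C"
    using nAB nBC nAC pos_iso_refl by metis+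
  have "3 \<le> card (hd vs - last vs)"
    using m3 unfolding m_def X_def by (simp add: Diff_Int)
  then interpret shortest_special_path Q n "iso_type Q {A, B, C}" vs
    using shortest_special_path_iso_type[OF posQ finQ wit rigid distinct sp minimal v0 vint vr Qunion]
    by blast
  have "S \<in> exch_vertices Q n" "\<not> hd vs - last vs \<subseteq> S" "\<not> last vs - hd vs \<subseteq> S"
    using S unfolding X_def mem_exch_vertices by (auto simp: Diff_Int)
  then have "iso_type Q {A, B, C} S = iso_type Q {A, B, C} (vs ! 1)"
    by (rule second_colour_if_misses_both_ends)
  also have "\<dots> = B"
    using iso_type_eq[OF wit rigid second_vertex] vint length_ge_3 by simp
  finally show "pos_iso (subpos Q S) B"
    using iso_type_in_iso(2)[OF wit \<open>S \<in> exch_vertices Q n\<close>] by simp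
qed

end
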